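(* For every simple graph $\Gamma$ there exists an integer $n\geq 1$ such that the right-angled Artin group $A_\Gamma$ embeds isomorphically into the Brin-Thompson group $nV$ (i.e. there is an injective group homomorphism $A_\Gamma\to nV$).
   Context: A simple graph is a finite (undirected) graph with no loops and no multiple edges. For a simple graph $\Gamma$, the right-angled Artin group $A_\Gamma$ is the group with one generator $g_v$ for each vertex $v$ of $\Gamma$ and one relation $g_vg_w=g_wg_v$ for each pair of vertices $v,w$ connected by an edge. Brin-Thompson group $nV$: let $X=(\{0,1\}^\omega)^n$, where $\{0,1\}^\omega$ is the space of infinite binary strings with the product topology. For a tuple $(\alpha_1,\dots,\alpha_n)$ of finite (possibly empty) binary strings, the subcube $X(\alpha_1,\dots,\alpha_n)$ is the set of all $(x_1,\dots,x_n)\in X$ such that $x_i$ begins with $\alpha_i$ for each $i$. The canonical homeomorphism between subcubes $X(\alpha_1,\dots,\alpha_n)$ and $X(\beta_1,\dots,\beta_n)$ is the prefix replacement $(\alpha_1\cdot x_1,\dots,\alpha_n\cdot x_n)\mapsto(\beta_1\cdot x_1,\dots,\beta_n\cdot x_n)$, where $\cdot$ is concatenation. A homeomorphism $h\colon X\to X$ belongs to $nV$ if and only if there are two partitions $D_1,\dots,D_k$ and $R_1,\dots,R_k$ of $X$ into the same finite number of subcubes such that $h$ maps each $D_i$ to $R_i$ by the canonical homeomorphism. The group operation is composition. *)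

theory Defs
  imports
    "HOL-Analysis.Analysis"
    "HOL-Library.Omega_Words_Fun"
    "HOL-Algebra.Bij"
    "Graph_Theory.Digraph"
begin

section \<open>Group presentations and right-angled Artin groups\<close>

text \<open>
  A group word over \<open>S\<close> is a list of letters, where \<open>(s, True)\<close> stands for the generator \<open>s\<close>
  and \<open>(s, False)\<close> for its formal inverse.
\<close>

definition group_words :: "'a set \<Rightarrow> ('a \<times> bool) list set" where
  "group_words S = lists (S \<times> UNIV)"

text \<open>
  Relations are pairs \<open>(l, r)\<close> of words, to be read as \<open>l = r\<close>. The equality of words in the
  presented group is the least congruence on words that contains these pairs and cancels
  adjacent mutually inverse letters.
\<close>

inductive_set presentation_cong ::
  "'a set \<Rightarrow> (('a \<times> bool) list \<times> ('a \<times> bool) list) set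
    \<Rightarrow> (('a \<times> bool) list \<times> ('a \<times> bool) list) set"
  for S R where
  refl: "u \<in> group_words S \<Longrightarrow> (u, u) \<in> presentation_cong S R"
| sym: "(u, v) \<in> presentation_cong S R \<Longrightarrow> (v, u) \<in> presentation_cong S R"
| trans: "(u, v) \<in> presentation_cong S R \<Longrightarrow> (v, w) \<in> presentation_cong S R
    \<Longrightarrow> (u, w) \<in> presentation_cong S R"
| cancel: "u \<in> group_words S \<Longrightarrow> v \<in> group_words S \<Longrightarrow> s \<in> S
    \<Longrightarrow> (u @ [(s, b), (s, \<not> b)] @ v, u @ v) \<in> presentation_cong S R"
| rel: "u \<in> group_words S \<Longrightarrow> v \<in> group_words S \<Longrightarrow> (l, r) \<in> R
    \<Longrightarrow> l \<in> group_words S \<Longrightarrow> r \<in> group_words S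
    \<Longrightarrow> (u @ l @ v, u @ r @ v) \<in> presentation_cong S R"

definition presented_group ::
  "'a set \<Rightarrow> (('a \<times> bool) list \<times> ('a \<times> bool) list) set \<Rightarrow> ('a \<times> bool) list set monoid" where
  "presented_group S R =
    \<lparr>carrier = group_words S // presentation_cong S R,
     mult = (\<lambda>A B. \<Union>a\<in>A. \<Union>b\<in>B. presentation_cong S R `` {a @ b}),
     one = presentation_cong S R `` {[]}\<rparr>"

text \<open>
  The locale \<open>Digraph.graph\<close> describes finite simple graphs as finite symmetric digraphs without
  loops and parallel arcs. An edge thus contributes its relation in both (equivalent) orientations.
\<close>

definition raag :: "('a, 'b) pre_digraph \<Rightarrow> ('a \<times> bool) list set monoid" where
  "raag G = presented_group (verts G)
    {([(v, True), (w, True)], [(w, True), (v, True)]) | v w. (v, w) \<in> arcs_ends G}"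

lemma presentation_cong_words:
  "(u, v) \<in> presentation_cong S R \<Longrightarrow> u \<in> group_words S \<and> v \<in> group_words S"
  by (induction rule: presentation_cong.induct) (auto simp: group_words_def)

lemma equiv_presentation_cong: "equiv (group_words S) (presentation_cong S R)"
  by (rule equivI)
    (auto simp: refl_on_def sym_def trans_def dest: presentation_cong_words
      intro: presentation_cong.refl presentation_cong.sym presentation_cong.trans)

lemma presentation_cong_context:
  assumes "(u, v) \<in> presentation_cong S R" "p \<in> group_words S" "q \<in> group_words S"
  shows "(p @ u @ q, p @ v @ q) \<in> presentation_cong S R"
  using assms
proof (induction rule: presentation_cong.induct)
  case (refl u)
  then show ?case by (auto simp: group_words_def intro!: presentation_cong.refl)
next
  case (sym u v)
  then show ?case by (blast intro: presentation_cong.sym)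
next
  case (trans u v w)
  then show ?case by (blast intro: presentation_cong.trans)
next
  case (cancel u v s b)
  then have "((p @ u) @ [(s, b), (s, \<not> b)] @ (v @ q), (p @ u) @ (v @ q)) \<in> presentation_cong S R"
    by (intro presentation_cong.cancel) (auto simp: group_words_def)
  then show ?case by simp
next
  case (rel u v l r)
  then have "((p @ u) @ l @ (v @ q), (p @ u) @ r @ (v @ q)) \<in> presentation_cong S R"
    by (intro presentation_cong.rel) (auto simp: group_words_def)
  then show ?case by simp
qed

lemma presentation_cong_append:
  assumes "(a, a') \<in> presentation_cong S R" "(b, b') \<in> presentation_cong S R"
  shows "(a @ b, a' @ b') \<in> presentation_cong S R"
proof -
  have nil: "[] \<in> group_words S" by (simp add: group_words_def)
  have "([] @ a @ b, [] @ a' @ b) \<in> presentation_cong S R"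
    using presentation_cong_context[OF assms(1) nil] presentation_cong_words[OF assms(2)] by blast
  moreover have "(a' @ b @ [], a' @ b' @ []) \<in> presentation_cong S R"
    using presentation_cong_context[OF assms(2) _ nil] presentation_cong_words[OF assms(1)] by blast
  ultimately show ?thesis by (auto intro: presentation_cong.trans)
qed

lemma presented_group_mult_class:
  assumes "a \<in> group_words S" "b \<in> group_words S"
  shows "presentation_cong S R `` {a} \<otimes>\<^bsub>presented_group S R\<^esub> presentation_cong S R `` {b}
    = presentation_cong S R `` {a @ b}"
proof -
  let ?A = "presentation_cong S R `` {a}" and ?B = "presentation_cong S R `` {b}"
  have eq: "presentation_cong S R `` {x @ y} = presentation_cong S R `` {a @ b}"
    if "x \<in> ?A" "y \<in> ?B" for x y
    using that
    by (auto intro!: equiv_class_eq[OF equiv_presentation_cong, symmetric] presentation_cong_append)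
  have "a \<in> ?A" "b \<in> ?B"
    using assms by (auto intro: presentation_cong.refl)
  then have ne: "?A \<noteq> {}" "?B \<noteq> {}" by blast+
  have "(\<Union>x\<in>?A. \<Union>y\<in>?B. presentation_cong S R `` {x @ y})
      = (\<Union>x\<in>?A. \<Union>y\<in>?B. presentation_cong S R `` {a @ b})"
    using eq by (intro SUP_cong refl) auto
  also have "\<dots> = presentation_cong S R `` {a @ b}"
    using ne by (simp only: UN_constant if_False)
  finally show ?thesis
    by (simp add: presented_group_def)
qed

lemma group_words_inverse:
  "a \<in> group_words S \<Longrightarrow>
    (rev (map (\<lambda>(s, b). (s, \<not> b)) a) @ a, []) \<in> presentation_cong S R"
proof (induction a)
  case Nil
  then show ?case by (auto intro: presentation_cong.refl)
next
  case (Cons x a)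
  obtain s b where x: "x = (s, b)" by (cases x)
  let ?i = "rev (map (\<lambda>(s, b). (s, \<not> b)) a)"
  have a: "a \<in> group_words S" "s \<in> S" and i: "?i \<in> group_words S"
    using Cons.prems by (auto simp: x group_words_def)
  have "(?i @ [(s, \<not> b), (s, \<not> \<not> b)] @ a, ?i @ a) \<in> presentation_cong S R"
    using i a by (rule presentation_cong.cancel)
  then show ?case
    using Cons.IH[OF a(1)] by (auto simp: x intro: presentation_cong.trans)
qed

lemma group_presented_group: "group (presented_group S R)"
proof -
  let ?G = "presented_group S R" and ?c = "\<lambda>a. presentation_cong S R `` {a}"
  have carr: "carrier ?G = ?c ` group_words S"
    by (auto simp: presented_group_def quotient_def)
  have one: "\<one>\<^bsub>?G\<^esub> = ?c []"
    by (simp add: presented_group_def)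
  have app: "a @ b \<in> group_words S" if "a \<in> group_words S" "b \<in> group_words S" for a b :: "('a \<times> bool) list"
    using that by (auto simp: group_words_def)
  have nil: "[] \<in> group_words S"
    by (simp add: group_words_def)
  show ?thesis
  proof (rule groupI)
    fix x assume "x \<in> carrier ?G"
    then obtain a where a: "a \<in> group_words S" "x = ?c a"
      unfolding carr by blast
    let ?i = "rev (map (\<lambda>(s, b). (s, \<not> b)) a)"
    have i: "?i \<in> group_words S"
      using a(1) by (auto simp: group_words_def)
    have "?c ?i \<otimes>\<^bsub>?G\<^esub> x = \<one>\<^bsub>?G\<^esub>"
      using presented_group_mult_class[OF i a(1)] a(2) one
        equiv_class_eq[OF equiv_presentation_cong group_words_inverse[OF a(1)]] by simp
    then show "\<exists>y\<in>carrier ?G. y \<otimes>\<^bsub>?G\<^esub> x = \<one>\<^bsub>?G\<^esub>"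
      using i unfolding carr by blast
  next
    fix x y assume "x \<in> carrier ?G" "y \<in> carrier ?G"
    then obtain a b where "a \<in> group_words S" "b \<in> group_words S" "x = ?c a" "y = ?c b"
      unfolding carr by blast
    then show "x \<otimes>\<^bsub>?G\<^esub> y \<in> carrier ?G"
      unfolding carr by (simp add: presented_group_mult_class app)
  next
    fix x y z assume "x \<in> carrier ?G" "y \<in> carrier ?G" "z \<in> carrier ?G"
    then obtain a b c where "a \<in> group_words S" "b \<in> group_words S" "c \<in> group_words S"
      "x = ?c a" "y = ?c b" "z = ?c c"
      unfolding carr by blast
    then show "x \<otimes>\<^bsub>?G\<^esub> y \<otimes>\<^bsub>?G\<^esub> z = x \<otimes>\<^bsub>?G\<^esub> (y \<otimes>\<^bsub>?G\<^esub> z)"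
      by (simp add: presented_group_mult_class app)
  next
    fix x assume "x \<in> carrier ?G"
    then obtain a where "a \<in> group_words S" "x = ?c a"
      unfolding carr by blast
    then show "\<one>\<^bsub>?G\<^esub> \<otimes>\<^bsub>?G\<^esub> x = x"
      unfolding one by (simp add: presented_group_mult_class nil)
  next
    show "\<one>\<^bsub>?G\<^esub> \<in> carrier ?G"
      unfolding one carr using nil by blast
  qed
qed

corollary group_raag: "group (raag G)"
  unfolding raag_def by (rule group_presented_group)


section \<open>The Brin-Thompson groups\<close>

definition cantor_space :: "bool word topology" where
  "cantor_space = product_topology (\<lambda>_. discrete_topology UNIV) UNIV"

definition cantor_power :: "nat \<Rightarrow> (nat \<Rightarrow> bool word) topology" where
  "cantor_power n = product_topology (\<lambda>_. cantor_space) {..<n}"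

lemma topspace_cantor_power: "topspace (cantor_power n) = (\<Pi>\<^sub>E i\<in>{..<n}. UNIV)"
  by (simp add: cantor_power_def cantor_space_def)

text \<open>A tuple of finite strings is given by \<open>\<alpha> i\<close> for \<open>i < n\<close>; the other values are irrelevant.\<close>

definition subcube :: "nat \<Rightarrow> (nat \<Rightarrow> bool list) \<Rightarrow> (nat \<Rightarrow> bool word) set" where
  "subcube n \<alpha> = {x \<in> topspace (cantor_power n). \<forall>i<n. \<exists>y. x i = \<alpha> i \<frown> y}"

definition prepend :: "nat \<Rightarrow> (nat \<Rightarrow> bool list) \<Rightarrow> (nat \<Rightarrow> bool word) \<Rightarrow> (nat \<Rightarrow> bool word)" where
  "prepend n \<alpha> x = (\<lambda>i\<in>{..<n}. \<alpha> i \<frown> x i)"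

text \<open>\<open>h\<close> restricts to the canonical homeomorphism from \<open>subcube n \<alpha>\<close> to \<open>subcube n \<beta>\<close>.\<close>

definition maps_canonically ::
  "nat \<Rightarrow> (nat \<Rightarrow> bool list) \<Rightarrow> (nat \<Rightarrow> bool list) \<Rightarrow> ((nat \<Rightarrow> bool word) \<Rightarrow> (nat \<Rightarrow> bool word)) \<Rightarrow> bool"
  where
  "maps_canonically n \<alpha> \<beta> h \<longleftrightarrow>
    (\<forall>x\<in>topspace (cantor_power n). h (prepend n \<alpha> x) = prepend n \<beta> x)"

definition subcube_partition :: "nat \<Rightarrow> nat \<Rightarrow> (nat \<Rightarrow> nat \<Rightarrow> bool list) \<Rightarrow> bool" where
  "subcube_partition n k D \<longleftrightarrow>
    disjoint_family_on (\<lambda>j. subcube n (D j)) {..<k} \<and>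
    (\<Union>j<k. subcube n (D j)) = topspace (cantor_power n)"

text \<open>
  As in \<^const>\<open>BijGroup\<close>, maps are extensional on the underlying space, so that equality
  in the group is equality of homeomorphisms; the product \<open>g \<otimes> f\<close> is \<open>g\<close> after \<open>f\<close>.
\<close>

definition brin_thompson_maps :: "nat \<Rightarrow> ((nat \<Rightarrow> bool word) \<Rightarrow> (nat \<Rightarrow> bool word)) set" where
  "brin_thompson_maps n =
    {h \<in> extensional (topspace (cantor_power n)).
      homeomorphic_map (cantor_power n) (cantor_power n) h \<and>
      (\<exists>k D R. subcube_partition n k D \<and> subcube_partition n k R \<and>
        (\<forall>j<k. maps_canonically n (D j) (R j) h))}"

definition brin_thompson :: "nat \<Rightarrow> ((nat \<Rightarrow> bool word) \<Rightarrow> (nat \<Rightarrow> bool word)) monoid" where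
  "brin_thompson n =
    (BijGroup (topspace (cantor_power n)))\<lparr>carrier := brin_thompson_maps n\<rparr>"

lemma brin_thompson_maps_subset_Bij:
  "brin_thompson_maps n \<subseteq> Bij (topspace (cantor_power n))"
  unfolding brin_thompson_maps_def Bij_def homeomorphic_map_def bij_betw_def
  using quotient_imp_surjective_map by blast

lemma subcube_eq_prepend_image:
  "subcube n \<alpha> = prepend n \<alpha> ` topspace (cantor_power n)"
proof
  show "prepend n \<alpha> ` topspace (cantor_power n) \<subseteq> subcube n \<alpha>"
    by (auto simp: subcube_def prepend_def topspace_cantor_power)
  show "subcube n \<alpha> \<subseteq> prepend n \<alpha> ` topspace (cantor_power n)"
  proof
    fix x assume x: "x \<in> subcube n \<alpha>"
    then obtain y where y: "\<And>i. i < n \<Longrightarrow> x i = \<alpha> i \<frown> y i"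
      unfolding subcube_def by simp metis
    have "x = prepend n \<alpha> (restrict y {..<n})"
      using x y by (auto simp: fun_eq_iff prepend_def subcube_def topspace_cantor_power PiE_def extensional_def)
    then show "x \<in> prepend n \<alpha> ` topspace (cantor_power n)"
      by (auto simp: topspace_cantor_power)
  qed
qed

end

theory Submission
  imports Defs "HOL-Algebra.Coset"
begin

text \<open>
  The proof is a ping-pong argument on the Cantor cube \<open>X = ({0,1}\<^sup>\<omega>)\<^sup>n\<close>.

  There is one coordinate \<open>t v\<close> of \<open>X\<close> for each vertex \<open>v\<close>, and one coordinate for each unordered
  pair of non-adjacent vertices, where \<open>{v, v}\<close> counts as such a pair. The generator of \<open>v\<close> acts on
  the coordinate \<open>t v\<close> and on the set \<open>P v\<close> of the coordinates of the pairs that contain \<open>v\<close>.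
  Adjacent vertices have no coordinate in common, so their generators commute, while
  non-adjacent vertices share the coordinate of their pair.

  Give the vertices code words \<open>c v\<close>, none of which is a prefix of another one, and let \<open>Q v\<close>
  be the cylinder of all points that begin with \<open>c v\<close> in all coordinates of \<open>P v\<close>. Non-adjacent
  distinct vertices have disjoint cylinders. The first digit in the coordinate \<open>t v\<close> splits \<open>Q v\<close>
  into two halves, and there is an element of \<open>nV\<close>, given by \<open>dilation\<close>, that maps the
  complement of one half onto the other half. These elements are the images of the generators.
  By von Dyck's theorem (\<open>presented_group_hom\<close>) they define a homomorphism.

  For injectivity, take a word \<open>u\<close> of minimal length among the words for its group element, and a
  point \<open>x0\<close> outside all cylinders. If \<open>u\<close> is not empty, it moves \<open>x0\<close> into the half that belongs to
  its first letter (\<open>raag_ping_pong\<close>), so it does not act trivially.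

  Membership in \<open>nV\<close> is handled through \<open>uniformly_canonical\<close>: an element of \<open>nV\<close> is the same as a
  bijection that acts by prefix replacement on all sufficiently deep subcubes. This
  shows that \<open>nV\<close> is closed under composition, and that \<open>dilation\<close> belongs to it.
\<close>

section \<open>Homomorphisms from presented groups\<close>

definition word_value :: "('g, 'm) monoid_scheme \<Rightarrow> ('a \<Rightarrow> 'g) \<Rightarrow> ('a \<times> bool) list \<Rightarrow> 'g" where
  "word_value H f w =
    foldr (\<lambda>(s, b) h. (if b then f s else inv\<^bsub>H\<^esub> f s) \<otimes>\<^bsub>H\<^esub> h) w \<one>\<^bsub>H\<^esub>"

lemma word_value_simps:
  "word_value H f [] = \<one>\<^bsub>H\<^esub>"
  "word_value H f ((s, b) # w) = (if b then f s else inv\<^bsub>H\<^esub> f s) \<otimes>\<^bsub>H\<^esub> word_value H f w"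
  by (simp_all add: word_value_def)

lemma group_words_simps [simp]:
  "[] \<in> group_words S"
  "x # w \<in> group_words S \<longleftrightarrow> fst x \<in> S \<and> w \<in> group_words S"
  "u @ w \<in> group_words S \<longleftrightarrow> u \<in> group_words S \<and> w \<in> group_words S"
  by (auto simp: group_words_def mem_Times_iff)

context group
begin

context
  fixes f :: "'c \<Rightarrow> 'a" and S :: "'c set"
  assumes f: "f \<in> S \<rightarrow> carrier G"
begin

lemma word_value_closed: "w \<in> group_words S \<Longrightarrow> word_value G f w \<in> carrier G"
  using f by (induction w) (auto simp: word_value_def Pi_iff)

lemma word_value_append:
  "u \<in> group_words S \<Longrightarrow> w \<in> group_words S \<Longrightarrow>
    word_value G f (u @ w) = word_value G f u \<otimes> word_value G f w"
proof (induction u)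
  case Nil
  then show ?case
    using word_value_closed by (simp add: word_value_def)
next
  case (Cons x u)
  obtain s b where x: "x = (s, b)" by (cases x)
  have "f s \<in> carrier G"
    using Cons.prems f by (auto simp: x)
  then show ?case
    using Cons word_value_closed[of u] word_value_closed[of w]
    by (auto simp: x word_value_def m_assoc)
qed

lemma word_value_cong:
  assumes "\<And>l r. (l, r) \<in> R \<Longrightarrow> l \<in> group_words S \<Longrightarrow> r \<in> group_words S \<Longrightarrow>
      word_value G f l = word_value G f r"
    and "(u, w) \<in> presentation_cong S R"
  shows "word_value G f u = word_value G f w"
  using assms(2)
proof (induction rule: presentation_cong.induct)
  case (cancel u v s b)
  have "f s \<in> carrier G"
    using cancel f by auto
  then have "word_value G f [(s, b), (s, \<not> b)] = \<one>"
    by (auto simp: word_value_def)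
  then show ?case
    using cancel word_value_closed
    by (simp add: word_value_append del: append.simps)
next
  case (rel u v l r)
  then show ?case
    using assms(1)[of l r] by (simp add: word_value_append)
qed auto

text \<open>
  Von Dyck's theorem: images of the generators that satisfy the relations extend to a homomorphism.
  The value of a word is constant on its congruence class, so the image of the class under
  \<^const>\<open>word_value\<close> is a singleton, whose element is the value of the homomorphism.
\<close>

lemma presented_group_hom:
  assumes "\<And>l r. (l, r) \<in> R \<Longrightarrow> l \<in> group_words S \<Longrightarrow> r \<in> group_words S \<Longrightarrow>
      word_value G f l = word_value G f r"
  obtains \<phi> where "\<phi> \<in> hom (presented_group S R) G"
    and "\<And>w. w \<in> group_words S \<Longrightarrow> \<phi> (presentation_cong S R `` {w}) = word_value G f w"
proof -
  define \<phi> where "\<phi> A = the_elem (word_value G f ` A)" for A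
  have val: "\<phi> (presentation_cong S R `` {w}) = word_value G f w" if w: "w \<in> group_words S" for w
  proof -
    have "word_value G f u = word_value G f w" if "u \<in> presentation_cong S R `` {w}" for u
      using word_value_cong[of R w u] assms that by simp
    moreover have "w \<in> presentation_cong S R `` {w}"
      using w by (simp add: presentation_cong.refl)
    ultimately have "word_value G f ` (presentation_cong S R `` {w}) = {word_value G f w}"
      by blast
    then show ?thesis
      by (simp add: \<phi>_def)
  qed
  have "\<phi> \<in> hom (presented_group S R) G"
  proof (rule homI)
    fix A assume "A \<in> carrier (presented_group S R)"
    then obtain a where "a \<in> group_words S" "A = presentation_cong S R `` {a}"
      by (auto simp: presented_group_def quotient_def)
    then show "\<phi> A \<in> carrier G"
      by (simp add: val word_value_closed)
  next
    fix A B assume "A \<in> carrier (presented_group S R)" "B \<in> carrier (presented_group S R)"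
    then obtain a b where "a \<in> group_words S" "A = presentation_cong S R `` {a}"
        "b \<in> group_words S" "B = presentation_cong S R `` {b}"
      by (auto simp: presented_group_def quotient_def)
    then show "\<phi> (A \<otimes>\<^bsub>presented_group S R\<^esub> B) = \<phi> A \<otimes> \<phi> B"
      by (simp add: presented_group_mult_class val word_value_append)
  qed
  then show thesis
    using val by (rule that)
qed

end

end

section \<open>Ping-pong for right-angled Artin groups\<close>

abbreviation raag_cong :: "('a, 'b) pre_digraph \<Rightarrow> (('a \<times> bool) list \<times> ('a \<times> bool) list) set" where
  "raag_cong G \<equiv> presentation_cong (verts G)
    {([(v, True), (w, True)], [(w, True), (v, True)]) | v w. (v, w) \<in> arcs_ends G}"

text \<open>
  The defining relations speak about positive letters only. Multiplying a commutation relation by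
  the inverse letter on both sides carries it over to that inverse letter.
\<close>

lemma presentation_cong_commute_inverse:
  assumes "([(v, True), x], [x, (v, True)]) \<in> presentation_cong S R"
  shows "([(v, a), x], [x, (v, a)]) \<in> presentation_cong S R"
proof (cases a)
  case False
  have v: "v \<in> S" and x: "fst x \<in> S"
    using presentation_cong_words[OF assms] by auto
  have "([(v, False), x] @ [(v, True), (v, \<not> True)] @ [], [(v, False), x] @ []) \<in> presentation_cong S R"
    using v x by (intro presentation_cong.cancel) auto
  moreover have "([(v, False)] @ [(v, True), x] @ [(v, False)], [(v, False)] @ [x, (v, True)] @ [(v, False)])
      \<in> presentation_cong S R"
    using v by (intro presentation_cong_context assms) auto
  moreover have "([] @ [(v, False), (v, \<not> False)] @ [x, (v, False)], [] @ [x, (v, False)]) \<in> presentation_cong S R"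
    using v x by (intro presentation_cong.cancel) auto
  ultimately have "([(v, False), x], [x, (v, False)]) \<in> presentation_cong S R"
    by simp (meson presentation_cong.sym presentation_cong.trans)
  then show ?thesis
    using False by simp
qed (use assms in simp)

lemma raag_letters_commute:
  assumes "Digraph.graph G" "(v, w) \<in> arcs_ends G"
  shows "([(v, a), (w, b)], [(w, b), (v, a)]) \<in> raag_cong G"
proof -
  interpret Digraph.graph G by fact
  have "v \<in> verts G" "w \<in> verts G"
    using assms(2) by (auto simp: arcs_ends_conv)
  then have "([] @ [(v, True), (w, True)] @ [], [] @ [(w, True), (v, True)] @ []) \<in> raag_cong G"
    using assms(2) by (intro presentation_cong.rel) auto
  then have "([(v, True), (w, True)], [(w, True), (v, True)]) \<in> raag_cong G"
    by simp
  then have "([(v, a), (w, True)], [(w, True), (v, a)]) \<in> raag_cong G"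
    by (rule presentation_cong_commute_inverse)
  then have "([(w, True), (v, a)], [(v, a), (w, True)]) \<in> raag_cong G"
    by (rule presentation_cong.sym)
  then have "([(w, b), (v, a)], [(v, a), (w, b)]) \<in> raag_cong G"
    by (rule presentation_cong_commute_inverse)
  then show ?thesis
    by (rule presentation_cong.sym)
qed

definition geodesic_word :: "('a, 'b) pre_digraph \<Rightarrow> ('a \<times> bool) list \<Rightarrow> bool" where
  "geodesic_word G u \<longleftrightarrow>
    u \<in> group_words (verts G) \<and> (\<forall>w. (u, w) \<in> raag_cong G \<longrightarrow> length u \<le> length w)"

lemma geodesic_word_tl:
  assumes "geodesic_word G (x # u)"
  shows "geodesic_word G u"
  unfolding geodesic_word_def
proof (intro conjI allI impI)
  show u: "u \<in> group_words (verts G)"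
    using assms by (simp add: geodesic_word_def)
  fix w assume w: "(u, w) \<in> raag_cong G"
  have "([x] @ u @ [], [x] @ w @ []) \<in> raag_cong G"
    using assms by (intro presentation_cong_context w) (auto simp: geodesic_word_def)
  then show "length u \<le> length w"
    using assms by (auto simp: geodesic_word_def)
qed

lemma ex_geodesic_word:
  assumes "u \<in> group_words (verts G)"
  obtains w where "(u, w) \<in> raag_cong G" "geodesic_word G w"
proof -
  have "(u, u) \<in> raag_cong G"
    using assms by (rule presentation_cong.refl)
  from ex_has_least_nat[of "\<lambda>w. (u, w) \<in> raag_cong G", OF this, of length]
  obtain w where w: "(u, w) \<in> raag_cong G"
    and least: "\<And>v. (u, v) \<in> raag_cong G \<Longrightarrow> length w \<le> length v"
    by blast
  have "geodesic_word G w"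
    unfolding geodesic_word_def
  proof (intro conjI allI impI)
    show "w \<in> group_words (verts G)"
      using presentation_cong_words[OF w] by simp
    show "length w \<le> length v" if "(w, v) \<in> raag_cong G" for v
      by (rule least) (rule presentation_cong.trans[OF w that])
  qed
  with w(1) show thesis
    by (rule that)
qed

text \<open>
  Each letter \<open>y\<close> has an attracting set \<open>P y\<close>: applying \<open>y\<close> moves every point into \<open>P y\<close>, except for
  the points in the attracting set of the inverse letter. Letters of adjacent vertices leave each
  other's sets invariant; all other pairs of distinct letters have disjoint sets, in particular
  a letter and its inverse.

  The key fact is that the position of \<open>u x0\<close> tells with which letters \<open>u\<close> can begin:
  if \<open>u\<close> is geodesic and \<open>u x0\<close> lies in \<open>P y\<close>, then \<open>u\<close> can be rewritten,
  without becoming longer, so that it begins with \<open>y\<close>.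
\<close>

context
  fixes G :: "('a, 'b) pre_digraph"
    and \<rho> :: "'a \<times> bool \<Rightarrow> 'x \<Rightarrow> 'x"
    and P :: "'a \<times> bool \<Rightarrow> 'x set"
    and x0 :: 'x
  assumes graph: "Digraph.graph G"
    and inverse: "\<And>s b x. s \<in> verts G \<Longrightarrow> \<rho> (s, \<not> b) (\<rho> (s, b) x) = x"
    and attract: "\<And>s b x. s \<in> verts G \<Longrightarrow> x \<notin> P (s, \<not> b) \<Longrightarrow> \<rho> (s, b) x \<in> P (s, b)"
    and disjoint: "\<And>s b t c. s \<in> verts G \<Longrightarrow> t \<in> verts G \<Longrightarrow> (s, t) \<notin> arcs_ends G \<Longrightarrow>
      (s, b) \<noteq> (t, c) \<Longrightarrow> P (s, b) \<inter> P (t, c) = {}"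
    and invariant: "\<And>s b t c x. (s, t) \<in> arcs_ends G \<Longrightarrow> x \<in> P (t, c) \<Longrightarrow> \<rho> (s, b) x \<in> P (t, c)"
    and base: "\<And>s b. s \<in> verts G \<Longrightarrow> x0 \<notin> P (s, b)"
begin

text \<open>
  The only obstacle to landing in the set of the first letter is that the rest of the word has moved
  the base point into the set of the inverse letter. By the hypothesis \<open>head\<close> the rest could then
  begin with this inverse letter, the two letters would cancel, and the word would not be geodesic.
\<close>

lemma ping_pong_step:
  assumes geo: "geodesic_word G ((s, b) # u)"
    and head: "foldr \<rho> u x0 \<in> P (s, \<not> b) \<Longrightarrow>
      \<exists>w. (u, (s, \<not> b) # w) \<in> raag_cong G \<and> length w < length u"
  shows "foldr \<rho> ((s, b) # u) x0 \<in> P (s, b)"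
proof -
  have s: "s \<in> verts G"
    using geo by (simp add: geodesic_word_def)
  have "foldr \<rho> u x0 \<notin> P (s, \<not> b)"
  proof
    assume "foldr \<rho> u x0 \<in> P (s, \<not> b)"
    then obtain w where w: "(u, (s, \<not> b) # w) \<in> raag_cong G" "length w < length u"
      using head by blast
    have "([(s, b)] @ u @ [], [(s, b)] @ ((s, \<not> b) # w) @ []) \<in> raag_cong G"
      using s by (intro presentation_cong_context w) auto
    moreover have "([] @ [(s, b), (s, \<not> b)] @ w, [] @ w) \<in> raag_cong G"
      using s presentation_cong_words[OF w(1)] by (intro presentation_cong.cancel) auto
    ultimately have "((s, b) # u, w) \<in> raag_cong G"
      by simp (meson presentation_cong.trans)
    then have "length ((s, b) # u) \<le> length w"
      using geo by (simp add: geodesic_word_def)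
    then show False
      using w(2) by simp
  qed
  then show ?thesis
    using attract[OF s] by simp
qed

text \<open>
  Induction on the word. The point lies in the set of the first letter \<open>(s, b)\<close>. If it also lies in
  the set of another letter \<open>(t, c)\<close>, disjointness forces \<open>s\<close> and \<open>t\<close> to be adjacent. Undoing
  the first letter keeps the point in the set of \<open>(t, c)\<close>; so by induction the rest can begin with
  \<open>(t, c)\<close>, and this letter commutes past the first one.
\<close>

lemma ping_pong_head:
  assumes "geodesic_word G u" "t \<in> verts G" "foldr \<rho> u x0 \<in> P (t, c)"
  shows "\<exists>w. (u, (t, c) # w) \<in> raag_cong G \<and> length w < length u"
  using assms
proof (induction u arbitrary: t c)
  case Nil
  then show ?case using base by simp
next
  case (Cons x u)
  obtain s b where x: "x = (s, b)" by (cases x)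
  have s: "s \<in> verts G" and u: "u \<in> group_words (verts G)"
    using Cons.prems(1) by (auto simp: geodesic_word_def x)
  have IH: "\<exists>w. (u, (t, c) # w) \<in> raag_cong G \<and> length w < length u"
    if "t \<in> verts G" "foldr \<rho> u x0 \<in> P (t, c)" for t c
    using Cons.IH[OF geodesic_word_tl[OF Cons.prems(1)]] that by blast
  have "foldr \<rho> (x # u) x0 \<in> P (s, b)"
    using ping_pong_step[of s b u] Cons.prems(1) IH s by (simp add: x)
  then have "P (s, b) \<inter> P (t, c) \<noteq> {}"
    using Cons.prems(3) by blast
  then consider "(s, b) = (t, c)" | "(s, t) \<in> arcs_ends G"
    using disjoint[OF s Cons.prems(2), of b c] by argo
  then show ?case
  proof cases
    case 1
    then show ?thesis
      using s u by (auto simp: x intro!: exI[of _ u] presentation_cong.refl)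
  next
    case 2
    have "\<rho> (s, \<not> b) (foldr \<rho> (x # u) x0) \<in> P (t, c)"
      using invariant[OF 2] Cons.prems(3) by blast
    then have "foldr \<rho> u x0 \<in> P (t, c)"
      using inverse[OF s] by (simp add: x)
    then obtain w where w: "(u, (t, c) # w) \<in> raag_cong G" "length w < length u"
      using IH Cons.prems(2) by blast
    have "w \<in> group_words (verts G)"
      using presentation_cong_words[OF w(1)] by simp
    then have "([] @ [(s, b), (t, c)] @ w, [] @ [(t, c), (s, b)] @ w) \<in> raag_cong G"
      by (intro presentation_cong_context[OF raag_letters_commute[OF graph 2]]) auto
    moreover have "([(s, b)] @ u @ [], [(s, b)] @ ((t, c) # w) @ []) \<in> raag_cong G"
      using s by (intro presentation_cong_context w) auto
    ultimately have "(x # u, (t, c) # (s, b) # w) \<in> raag_cong G"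
      by (simp add: x) (meson presentation_cong.trans)
    then show ?thesis
      using w(2) by (intro exI[of _ "(s, b) # w"]) simp
  qed
qed

text \<open>
  A nonempty geodesic word moves the base point into the set of its first letter, and the
  base point lies in none of these sets.
\<close>

theorem raag_ping_pong:
  assumes "geodesic_word G u" "foldr \<rho> u x0 = x0"
  shows "u = []"
proof (cases u)
  case (Cons x v)
  obtain s b where x: "x = (s, b)" by (cases x)
  have s: "s \<in> verts G"
    using assms(1) by (simp add: geodesic_word_def Cons x)
  then have "\<exists>w. (v, (s, \<not> b) # w) \<in> raag_cong G \<and> length w < length v"
    if "foldr \<rho> v x0 \<in> P (s, \<not> b)"
    using ping_pong_head[of v s "\<not> b"] geodesic_word_tl[of G x v] assms(1) that by (simp add: Cons)
  then have "foldr \<rho> u x0 \<in> P (s, b)"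
    using ping_pong_step[of s b v] assms(1) by (simp add: Cons x)
  then show ?thesis
    using base[OF s] assms(2) by simp
qed

end

section \<open>Elements of the Brin-Thompson groups\<close>

lemma prepend_in_cantor_power [simp]: "prepend n \<alpha> x \<in> topspace (cantor_power n)"
  by (simp add: prepend_def topspace_cantor_power)

lemma prepend_prepend: "prepend n \<alpha> (prepend n \<beta> x) = prepend n (\<lambda>i. \<alpha> i @ \<beta> i) x"
  by (auto simp: prepend_def fun_eq_iff)

lemma prepend_cong: "(\<And>i. i < n \<Longrightarrow> \<alpha> i = \<beta> i) \<Longrightarrow> prepend n \<alpha> x = prepend n \<beta> x"
  by (auto simp: prepend_def)

lemma maps_canonically_append:
  assumes "maps_canonically n \<alpha> \<beta> h"
  shows "maps_canonically n (\<lambda>i. \<alpha> i @ \<gamma> i) (\<lambda>i. \<beta> i @ \<gamma> i) h"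
  using assms by (simp add: maps_canonically_def prepend_prepend [symmetric])

lemma maps_canonically_cong:
  "(\<And>i. i < n \<Longrightarrow> \<alpha> i = \<alpha>' i) \<Longrightarrow> maps_canonically n \<alpha> \<beta> h \<longleftrightarrow> maps_canonically n \<alpha>' \<beta> h"
  using prepend_cong[of n \<alpha> \<alpha>'] by (simp add: maps_canonically_def)

text \<open>
  A description of the elements of \<open>nV\<close> without a table of subcubes: among the bijections of the
  space they are those that act by prefix replacement on every sufficiently deep subcube.
  Unlike pairs of partitions, which have to be refined against each other, this property
  visibly passes to compositions.
\<close>

definition uniformly_canonical :: "nat \<Rightarrow> nat \<Rightarrow> ((nat \<Rightarrow> bool word) \<Rightarrow> (nat \<Rightarrow> bool word)) \<Rightarrow> bool" where
  "uniformly_canonical n L h \<longleftrightarrow>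
    (\<forall>\<alpha>. (\<forall>i<n. L \<le> length (\<alpha> i)) \<longrightarrow> (\<exists>\<beta>. maps_canonically n \<alpha> \<beta> h))"

text \<open>
  Lengthening the prefixes of a source cube by \<open>m\<close> letters beyond the depth \<open>L\<close> lengthens those of
  the image cube by the same letters. So the image can be made as deep as desired.
\<close>

lemma uniformly_canonical_long_image:
  assumes "uniformly_canonical n L h" "\<And>i. i < n \<Longrightarrow> L + m \<le> length (\<alpha> i)"
  obtains \<beta> where "maps_canonically n \<alpha> \<beta> h" "\<And>i. i < n \<Longrightarrow> m \<le> length (\<beta> i)"
proof -
  have "L \<le> length (take L (\<alpha> i))" if "i < n" for i
    using assms(2)[OF that] by simp
  then obtain \<beta> where "maps_canonically n (\<lambda>i. take L (\<alpha> i)) \<beta> h"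
    using assms(1) unfolding uniformly_canonical_def by meson
  then have "maps_canonically n \<alpha> (\<lambda>i. \<beta> i @ drop L (\<alpha> i)) h"
    using maps_canonically_append[of n "\<lambda>i. take L (\<alpha> i)" \<beta> h "\<lambda>i. drop L (\<alpha> i)"] by simp
  moreover have "m \<le> length (\<beta> i @ drop L (\<alpha> i))" if "i < n" for i
    using assms(2)[OF that] by simp
  ultimately show thesis
    by (rule that)
qed

lemma uniformly_canonical_compose:
  assumes "uniformly_canonical n L h" "uniformly_canonical n M k"
  shows "uniformly_canonical n (L + M) (compose (topspace (cantor_power n)) k h)"
  unfolding uniformly_canonical_def
proof (intro allI impI)
  fix \<alpha> :: "nat \<Rightarrow> bool list" assume "\<forall>i<n. L + M \<le> length (\<alpha> i)"
  then obtain \<beta> where \<beta>: "maps_canonically n \<alpha> \<beta> h" "\<And>i. i < n \<Longrightarrow> M \<le> length (\<beta> i)"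
    using uniformly_canonical_long_image[OF assms(1), of M \<alpha>] by blast
  then obtain \<gamma> where "maps_canonically n \<beta> \<gamma> k"
    using assms(2) unfolding uniformly_canonical_def by blast
  then have "maps_canonically n \<alpha> \<gamma> (compose (topspace (cantor_power n)) k h)"
    using \<beta>(1) by (simp add: maps_canonically_def compose_def)
  then show "\<exists>\<gamma>. maps_canonically n \<alpha> \<gamma> (compose (topspace (cantor_power n)) k h)"
    by blast
qed

lemma openin_subcube: "openin (cantor_power n) (subcube n \<alpha>)"
proof -
  let ?X = "topspace (cantor_power n)" and ?I = "SIGMA i:{..<n}. {..<length (\<alpha> i)}"
  have "openin (cantor_power n) {x \<in> ?X. x i m \<in> {\<alpha> i ! m}}" if "i < n" for i m
  proof -
    have "continuous_map (cantor_power n) cantor_space (\<lambda>x. x i)"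
      using that unfolding cantor_power_def by (intro continuous_map_product_projection) simp
    then have "continuous_map (cantor_power n) (discrete_topology UNIV) (\<lambda>x. x i m)"
      unfolding cantor_space_def continuous_map_componentwise_UNIV by blast
    then show ?thesis
      by (rule openin_continuous_map_preimage) simp
  qed
  then have "openin (cantor_power n) ((\<Inter>(i, m)\<in>?I. {x \<in> ?X. x i m \<in> {\<alpha> i ! m}}) \<inter> ?X)"
    by (intro openin_INT) auto
  moreover have "(\<exists>y. w = u \<frown> y) \<longleftrightarrow> (\<forall>m<length u. w m = u ! m)" for w :: "bool word" and u
  proof
    assume "\<forall>m<length u. w m = u ! m"
    then have "w = u \<frown> suffix (length u) w"
      by (auto simp: fun_eq_iff conc_def)
    then show "\<exists>y. w = u \<frown> y"
      by blast
  qed auto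
  then have "subcube n \<alpha> = (\<Inter>(i, m)\<in>?I. {x \<in> ?X. x i m \<in> {\<alpha> i ! m}}) \<inter> ?X"
    by (auto simp: subcube_def)
  ultimately show ?thesis
    by simp
qed

text \<open>
  The digit of \<open>h x\<close> at position \<open>m\<close> is already determined by the first \<open>L + m + 1\<close> digits of all
  coordinates of \<open>x\<close>: on the corresponding subcube \<open>h\<close> is a prefix replacement whose new prefixes
  have more than \<open>m\<close> digits.
\<close>

lemma uniformly_canonical_imp_continuous:
  assumes h: "h \<in> topspace (cantor_power n) \<rightarrow> topspace (cantor_power n)"
    and "uniformly_canonical n L h"
  shows "continuous_map (cantor_power n) (cantor_power n) h"
proof -
  let ?X = "topspace (cantor_power n)"
  have "openin (cantor_power n) {x \<in> ?X. h x i m \<in> U}" if i: "i < n" for i m U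
  proof (subst openin_subopen, intro ballI)
    fix x assume x: "x \<in> {x \<in> ?X. h x i m \<in> U}"
    define \<alpha> where "\<alpha> i = prefix (L + Suc m) (x i)" for i
    obtain \<beta> where \<beta>: "maps_canonically n \<alpha> \<beta> h" "\<And>i. i < n \<Longrightarrow> Suc m \<le> length (\<beta> i)"
      using uniformly_canonical_long_image[OF assms(2), of "Suc m" \<alpha>] by (auto simp: \<alpha>_def)
    have digit: "h y i m = \<beta> i ! m" if y: "y \<in> subcube n \<alpha>" for y
    proof -
      obtain z where "z \<in> ?X" "y = prepend n \<alpha> z"
        using y by (auto simp: subcube_eq_prepend_image)
      then have "h y = prepend n \<beta> z"
        using \<beta>(1) by (simp add: maps_canonically_def)
      then show ?thesis
        using \<beta>(2)[OF i] i by (simp add: prepend_def)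
    qed
    have "x \<in> subcube n \<alpha>"
      using x prefix_suffix[of _ "L + Suc m"] unfolding subcube_def \<alpha>_def by blast
    moreover have "subcube n \<alpha> \<subseteq> {x \<in> ?X. h x i m \<in> U}"
      using digit x \<open>x \<in> subcube n \<alpha>\<close> by (auto simp: subcube_def)
    ultimately show "\<exists>T. openin (cantor_power n) T \<and> x \<in> T \<and> T \<subseteq> {x \<in> ?X. h x i m \<in> U}"
      using openin_subcube by blast
  qed
  then have "continuous_map (cantor_power n) cantor_space (\<lambda>x. h x i)" if "i < n" for i
    using that unfolding cantor_space_def continuous_map_componentwise_UNIV by (simp add: continuous_map)
  moreover have "h ` ?X \<subseteq> extensional {..<n}"
    using h by (auto simp: topspace_cantor_power PiE_def Pi_iff)
  ultimately show ?thesis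
    by (subst (2) cantor_power_def) (simp add: continuous_map_componentwise)
qed

lemma compact_Hausdorff_cantor_power:
  "compact_space (cantor_power n)" "Hausdorff_space (cantor_power n)"
  by (auto simp: cantor_power_def cantor_space_def compact_space_product_topology
      Hausdorff_space_product_topology compact_space_discrete_topology)

text \<open>
  A subcube whose prefixes are at least as long as all prefixes in the domain partition cannot be
  cut by that partition, so it lies inside one of its members.
\<close>

lemma brin_thompson_imp_uniformly_canonical:
  assumes "h \<in> brin_thompson_maps n"
  obtains L where "uniformly_canonical n L h"
proof -
  obtain k D R where D: "subcube_partition n k D"
    and h: "\<And>j. j < k \<Longrightarrow> maps_canonically n (D j) (R j) h"
    using assms unfolding brin_thompson_maps_def by blast
  define L where "L = (\<Sum>j<k. \<Sum>i<n. length (D j i))"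
  have L: "length (D j i) \<le> L" if "j < k" "i < n" for j i
  proof -
    have "length (D j i) \<le> (\<Sum>i<n. length (D j i))"
      using that by (intro member_le_sum) auto
    also have "\<dots> \<le> L"
      unfolding L_def using that by (intro member_le_sum) auto
    finally show ?thesis .
  qed
  have "uniformly_canonical n L h"
    unfolding uniformly_canonical_def
  proof (intro allI impI)
    fix \<alpha> :: "nat \<Rightarrow> bool list" assume \<alpha>: "\<forall>i<n. L \<le> length (\<alpha> i)"
    (* Any point of the cube locates the member of the partition that contains the whole cube. *)
    have "prepend n \<alpha> x \<in> (\<Union>j<k. subcube n (D j))" for x
      using D by (simp add: subcube_partition_def)
    then obtain j where j: "j < k" "prepend n \<alpha> undefined \<in> subcube n (D j)"
      by blast
    have "\<alpha> i = D j i @ drop (length (D j i)) (\<alpha> i)" if i: "i < n" for i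
    proof -
      obtain y where "\<alpha> i \<frown> undefined i = D j i \<frown> y"
        using j(2) i by (auto simp: subcube_def prepend_def)
      then have "take (length (D j i)) (prefix (length (\<alpha> i)) (\<alpha> i \<frown> undefined i))
          = take (length (D j i)) (prefix (length (\<alpha> i)) (D j i \<frown> y))"
        by simp
      then have "take (length (D j i)) (\<alpha> i) = D j i"
        using order_trans[OF L[OF j(1) i]] \<alpha> i by (simp add: min_absorb1)
      then show ?thesis
        by (metis append_take_drop_id)
    qed
    then have "maps_canonically n \<alpha> (\<lambda>i. R j i @ drop (length (D j i)) (\<alpha> i)) h"
      using maps_canonically_append[OF h[OF j(1)], of "\<lambda>i. drop (length (D j i)) (\<alpha> i)"]
        maps_canonically_cong[of n \<alpha> "\<lambda>i. D j i @ drop (length (D j i)) (\<alpha> i)"] by blast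
    then show "\<exists>\<beta>. maps_canonically n \<alpha> \<beta> h"
      by blast
  qed
  then show thesis
    by (rule that)
qed

text \<open>
  The finitely many subcubes of depth exactly \<open>L\<close> form the domain partition. Their images form
  the range partition because \<open>h\<close> is bijective. As the space is compact and Hausdorff, continuity
  of \<open>h\<close> suffices for a homeomorphism.
\<close>

lemma uniformly_canonical_imp_brin_thompson:
  assumes h: "h \<in> Bij (topspace (cantor_power n))" and canon: "uniformly_canonical n L h"
  shows "h \<in> brin_thompson_maps n"
proof -
  let ?X = "topspace (cantor_power n)"
  have ext: "h \<in> extensional ?X" and bij: "bij_betw h ?X ?X"
    using h by (auto simp: Bij_def)
  have "continuous_map (cantor_power n) (cantor_power n) h"
    using bij canon by (intro uniformly_canonical_imp_continuous) (auto dest: bij_betw_imp_funcset)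
  then have homeo: "homeomorphic_map (cantor_power n) (cantor_power n) h"
    using bij compact_Hausdorff_cantor_power
    by (intro continuous_imp_homeomorphic_map) (auto simp: bij_betw_def)
  define T :: "(nat \<Rightarrow> bool list) set" where "T = {..<n} \<rightarrow>\<^sub>E {u. length u = L}"
  have "finite {u :: bool list. length u = L}"
    using finite_lists_length_eq[of "UNIV :: bool set" L] by simp
  then have "finite T"
    by (simp add: T_def finite_PiE)
  then obtain D where D: "bij_betw D {..<card T} T"
    using ex_bij_betw_nat_finite[of T] by (auto simp: lessThan_atLeast0)
  have "\<exists>\<beta>. maps_canonically n (D j) \<beta> h" if "j < card T" for j
    using canon bij_betwE[OF D, rule_format, of j] that
    by (auto simp: uniformly_canonical_def T_def PiE_def Pi_iff)
  then obtain R where R: "\<And>j. j < card T \<Longrightarrow> maps_canonically n (D j) (R j) h"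
    by metis
  have img: "subcube n (R j) = h ` subcube n (D j)" if "j < card T" for j
    using R[OF that] by (auto simp: subcube_eq_prepend_image maps_canonically_def image_iff)
  have sub: "subcube n \<alpha> \<subseteq> ?X" for \<alpha>
    by (auto simp: subcube_def)
  have unique: "\<alpha> = \<beta>" if \<alpha>: "\<alpha> \<in> T" and \<beta>: "\<beta> \<in> T" and x: "x \<in> subcube n \<alpha>" "x \<in> subcube n \<beta>" for \<alpha> \<beta> x
  proof (rule PiE_ext)
    show "\<alpha> \<in> {..<n} \<rightarrow>\<^sub>E {u. length u = L}" "\<beta> \<in> {..<n} \<rightarrow>\<^sub>E {u. length u = L}"
      using \<alpha> \<beta> by (auto simp: T_def)
    fix i assume i: "i \<in> {..<n}"
    have "length (\<alpha> i) = L" "length (\<beta> i) = L"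
      using \<alpha> \<beta> i by (auto simp: T_def PiE_def Pi_iff)
    moreover obtain y where "x i = \<alpha> i \<frown> y"
      using x(1) i by (auto simp: subcube_def)
    moreover obtain z where "x i = \<beta> i \<frown> z"
      using x(2) i by (auto simp: subcube_def)
    ultimately show "\<alpha> i = \<beta> i"
      by (metis prefix_conc_length)
  qed
  have disj: "disjoint_family_on (\<lambda>j. subcube n (D j)) {..<card T}"
    using D unique by (auto simp: disjoint_family_on_def bij_betw_def inj_on_def) blast
  have "\<exists>j<card T. x \<in> subcube n (D j)" if x: "x \<in> ?X" for x
  proof -
    define \<alpha> where "\<alpha> = (\<lambda>i\<in>{..<n}. prefix L (x i))"
    have "\<alpha> \<in> T"
      by (auto simp: \<alpha>_def T_def)
    then obtain j where "j < card T" "D j = \<alpha>"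
      using D by (metis bij_betw_def imageE lessThan_iff)
    moreover have "x i = \<alpha> i \<frown> suffix L (x i)" if "i < n" for i
      using that by (simp add: \<alpha>_def)
    then have "x \<in> subcube n \<alpha>"
      using x by (auto simp: subcube_def)
    ultimately show ?thesis
      by blast
  qed
  then have cover: "(\<Union>j<card T. subcube n (D j)) = ?X"
    using sub by fastforce
  have "subcube_partition n (card T) D"
    using disj cover by (simp add: subcube_partition_def)
  moreover have "disjoint_family_on (\<lambda>j. subcube n (R j)) {..<card T}"
    unfolding disjoint_family_on_def
  proof (intro ballI impI)
    fix i j assume ij: "i \<in> {..<card T}" "j \<in> {..<card T}" "i \<noteq> j"
    have "h ` subcube n (D i) \<inter> h ` subcube n (D j) = h ` (subcube n (D i) \<inter> subcube n (D j))"
      using bij sub by (intro inj_on_image_Int[symmetric]) (auto simp: bij_betw_def)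
    then show "subcube n (R i) \<inter> subcube n (R j) = {}"
      using disj ij by (simp add: disjoint_family_on_def img)
  qed
  then have "subcube_partition n (card T) R"
    using cover bij unfolding subcube_partition_def
    by (simp add: img bij_betw_def flip: image_UN)
  ultimately show ?thesis
    using ext homeo R unfolding brin_thompson_maps_def by blast
qed

lemma brin_thompson_inverse:
  assumes h: "h \<in> brin_thompson_maps n"
  shows "(\<lambda>x\<in>topspace (cantor_power n). inv_into (topspace (cantor_power n)) h x)
    \<in> brin_thompson_maps n" (is "?h' \<in> _")
proof -
  let ?X = "topspace (cantor_power n)"
  obtain k D R where "subcube_partition n k D" "subcube_partition n k R"
    and R: "\<And>j. j < k \<Longrightarrow> maps_canonically n (D j) (R j) h"
    using h unfolding brin_thompson_maps_def by fast
  have bij: "bij_betw h ?X ?X"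
    using h brin_thompson_maps_subset_Bij by (auto simp: Bij_def)
  have "homeomorphic_map (cantor_power n) (cantor_power n) h"
    using h by (simp add: brin_thompson_maps_def)
  then obtain g where g: "homeomorphic_maps (cantor_power n) (cantor_power n) h g"
    by (auto simp: homeomorphic_map_maps)
  have inv: "?h' x = g x" if "x \<in> ?X" for x
    using g that bij by (auto simp: homeomorphic_maps_def bij_betw_def continuous_map_def Pi_iff
        intro!: inv_into_f_eq)
  have "homeomorphic_map (cantor_power n) (cantor_power n) g"
    unfolding homeomorphic_map_maps using g homeomorphic_maps_sym by blast
  then have "homeomorphic_map (cantor_power n) (cantor_power n) ?h'"
    using inv by (metis homeomorphic_map_eq)
  moreover have "maps_canonically n (R j) (D j) ?h'" if "j < k" for j
    using R[OF that] bij by (simp add: maps_canonically_def bij_betw_def) (metis inv_into_f_f prepend_in_cantor_power)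
  ultimately show ?thesis
    using \<open>subcube_partition n k D\<close> \<open>subcube_partition n k R\<close>
    unfolding brin_thompson_maps_def by blast
qed

lemma mult_BijGroup:
  "f \<in> Bij S \<Longrightarrow> g \<in> Bij S \<Longrightarrow> f \<otimes>\<^bsub>BijGroup S\<^esub> g = compose S f g"
  by (simp add: BijGroup_def)

lemma subgroup_brin_thompson:
  "subgroup (brin_thompson_maps n) (BijGroup (topspace (cantor_power n)))"
proof -
  let ?X = "topspace (cantor_power n)"
  interpret B: group "BijGroup ?X"
    by (rule group_BijGroup)
  have Bij: "h \<in> Bij ?X" if "h \<in> brin_thompson_maps n" for h
    using that brin_thompson_maps_subset_Bij by blast
  show ?thesis
  proof (rule B.subgroupI)
    show "brin_thompson_maps n \<subseteq> carrier (BijGroup ?X)"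
      using Bij by (auto simp: BijGroup_def)
    have "uniformly_canonical n 0 (\<lambda>x\<in>?X. x)"
      by (auto simp: uniformly_canonical_def maps_canonically_def)
    then show "brin_thompson_maps n \<noteq> {}"
      using uniformly_canonical_imp_brin_thompson[OF id_Bij] by blast
  next
    fix h assume h: "h \<in> brin_thompson_maps n"
    have "inv\<^bsub>BijGroup ?X\<^esub> h = (\<lambda>x\<in>?X. inv_into ?X h x)"
      using Bij[OF h] restrict_inv_into_Bij[of h ?X]
      by (intro B.inv_equality)
        (auto simp: mult_BijGroup Bij_compose_restrict_eq, auto simp: BijGroup_def)
    then show "inv\<^bsub>BijGroup ?X\<^esub> h \<in> brin_thompson_maps n"
      using brin_thompson_inverse[OF h] by simp
  next
    fix g h assume g: "g \<in> brin_thompson_maps n" and h: "h \<in> brin_thompson_maps n"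
    obtain L M where "uniformly_canonical n L g" "uniformly_canonical n M h"
      using brin_thompson_imp_uniformly_canonical g h by metis
    then have "compose ?X g h \<in> brin_thompson_maps n"
      using Bij g h
      by (intro uniformly_canonical_imp_brin_thompson[of _ _ "M + L"] compose_Bij
          uniformly_canonical_compose) auto
    then show "g \<otimes>\<^bsub>BijGroup ?X\<^esub> h \<in> brin_thompson_maps n"
      using Bij g h by (simp add: mult_BijGroup)
  qed
qed

lemma group_brin_thompson: "group (brin_thompson n)"
  unfolding brin_thompson_def
  by (rule subgroup.subgroup_is_group[OF subgroup_brin_thompson group_BijGroup])

section \<open>Generators with disjoint attracting sets\<close>

definition starts_with :: "nat set \<Rightarrow> bool list \<Rightarrow> (nat \<Rightarrow> bool word) \<Rightarrow> bool" where
  "starts_with P c x \<longleftrightarrow> (\<forall>p\<in>P. prefix (length c) (x p) = c)"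

definition push :: "nat set \<Rightarrow> bool list \<Rightarrow> (nat \<Rightarrow> bool word) \<Rightarrow> (nat \<Rightarrow> bool word)" where
  "push P c x = (\<lambda>p. if p \<in> P then c \<frown> x p else x p)"

definition pull :: "nat set \<Rightarrow> bool list \<Rightarrow> (nat \<Rightarrow> bool word) \<Rightarrow> (nat \<Rightarrow> bool word)" where
  "pull P c x = (\<lambda>p. if p \<in> P then suffix (length c) (x p) else x p)"

text \<open>
  Let \<open>Q\<close> be the cylinder of all points that begin with \<open>c\<close> in every coordinate of \<open>P\<close>. Prepending
  \<open>c\<close> there (\<^const>\<open>push\<close>) is a bijection from the whole space onto \<open>Q\<close>. The first digit in
  a coordinate \<open>t\<close> outside \<open>P\<close> divides \<open>Q\<close> into two halves \<open>Q\<^sub>0\<close> and \<open>Q\<^sub>1\<close>, the two \<open>poles\<close> defined below.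

  The map has to send the complement of \<open>Q\<^bsub>\<not> e\<^esub>\<close> onto \<open>Q\<^sub>e\<close>. Pushing sends \<open>Q\<^sub>e\<close> onto the
  part of \<open>Q\<^sub>e\<close> in the twofold cylinder \<open>push Q\<close>. A point outside \<open>Q\<close> is pushed too, and its
  coordinate \<open>t\<close> receives the additional digit \<open>e\<close>; these points fill exactly the remaining
  part of \<open>Q\<^sub>e\<close>. The last two cases are the inverse of these two rules for the opposite sign, so the maps
  for the two signs are inverse to each other.
\<close>

definition dilation ::
  "nat set \<Rightarrow> bool list \<Rightarrow> nat \<Rightarrow> bool \<Rightarrow> (nat \<Rightarrow> bool word) \<Rightarrow> (nat \<Rightarrow> bool word)" where
  "dilation P c t e x =
    (if \<not> starts_with P c x then (push P c x)(t := e ## x t)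
     else if x t 0 = e then push P c x
     else if starts_with P c (pull P c x) then pull P c x
     else (pull P c x)(t := suffix 1 (x t)))"

definition pole :: "nat set \<Rightarrow> bool list \<Rightarrow> nat \<Rightarrow> bool \<Rightarrow> (nat \<Rightarrow> bool word) set" where
  "pole P c t e = {x. starts_with P c x \<and> x t 0 = e}"

lemma starts_with_push [simp]: "starts_with P c (push P c x)"
  by (simp add: starts_with_def push_def)

lemma pull_push [simp]: "pull P c (push P c x) = x"
  by (auto simp: pull_def push_def)

lemma push_pull [simp]:
  assumes "starts_with P c x"
  shows "push P c (pull P c x) = x"
proof -
  have "c \<frown> suffix (length c) (x p) = x p" if "prefix (length c) (x p) = c" for p
    using prefix_suffix[of "x p" "length c", symmetric] unfolding that .
  then show ?thesis
    using assms by (auto simp: starts_with_def push_def pull_def)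
qed

lemma push_pull_outside [simp]:
  assumes "t \<notin> P"
  shows "starts_with P c (x(t := w)) \<longleftrightarrow> starts_with P c x"
    "push P c (x(t := w)) = (push P c x)(t := w)"
    "pull P c (x(t := w)) = (pull P c x)(t := w)"
    "push P c x t = x t" "pull P c x t = x t"
  using assms by (auto simp: starts_with_def push_def pull_def)

lemma build_suffix [simp]:
  "suffix (Suc 0) (a ## w) = w" "w 0 = a \<Longrightarrow> a ## suffix (Suc 0) w = w"
  by (simp add: fun_eq_iff, auto)

lemma dilation_inverse:
  assumes "t \<notin> P"
  shows "dilation P c t (\<not> e) (dilation P c t e x) = x"
  using assms by (auto simp: dilation_def fun_upd_idem)

lemma dilation_attract:
  assumes "t \<notin> P" "x \<notin> pole P c t (\<not> e)"
  shows "dilation P c t e x \<in> pole P c t e"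
  using assms by (auto simp: dilation_def pole_def)

text \<open>
  The map \<open>f\<close> changes only the coordinates in \<open>s\<close>, and their new values depend only on their old
  values; that is, \<open>f\<close> is a product of a map on the coordinates in \<open>s\<close> and an identity map.
\<close>

definition supported_on :: "'i set \<Rightarrow> (('i \<Rightarrow> 'w) \<Rightarrow> ('i \<Rightarrow> 'w)) \<Rightarrow> bool" where
  "supported_on s f \<longleftrightarrow> (\<forall>x p. p \<notin> s \<longrightarrow> f x p = x p) \<and>
    (\<forall>x y. (\<forall>p\<in>s. x p = y p) \<longrightarrow> (\<forall>p\<in>s. f x p = f y p))"

lemma supported_on_commute:
  assumes f: "supported_on s f" and g: "supported_on s' g" and "s \<inter> s' = {}"
  shows "f (g x) = g (f x)"
proof
  fix p
  have fg: "f (g x) p = f x p" if "p \<in> s"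
    using f g assms(3) that unfolding supported_on_def by (metis disjoint_iff)
  have gf: "g (f x) p = g x p" if "p \<in> s'"
    using f g assms(3) that unfolding supported_on_def by (metis disjoint_iff)
  show "f (g x) p = g (f x) p"
    using f g fg gf assms(3) unfolding supported_on_def by (metis disjoint_iff)
qed

lemma supported_on_dilation: "supported_on (insert t P) (dilation P c t e)"
proof -
  have "dilation P c t e x p = dilation P c t e y p"
    if eq: "\<forall>p\<in>insert t P. x p = y p" and p: "p \<in> insert t P" for x y p
  proof -
    have "starts_with P c x = starts_with P c y"
      "starts_with P c (pull P c x) = starts_with P c (pull P c y)"
      using eq by (auto simp: starts_with_def pull_def)
    then show ?thesis
      using eq p by (auto simp: dilation_def push_def pull_def)
  qed
  then show ?thesis
    by (auto simp: supported_on_def) (auto simp: dilation_def push_def pull_def)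
qed

lemma pole_invariant:
  assumes "supported_on s f" "s \<inter> insert t P = {}" "x \<in> pole P c t e"
  shows "f x \<in> pole P c t e"
proof -
  have "f x p = x p" if "p \<in> insert t P" for p
  proof -
    have "p \<notin> s"
      using assms(2) that by blast
    then show ?thesis
      using assms(1) by (simp add: supported_on_def)
  qed
  then show ?thesis
    using assms(3) by (simp add: pole_def starts_with_def)
qed

context
  fixes n t :: nat and P :: "nat set"
  assumes P: "P \<subseteq> {..<n}" and t: "t < n" "t \<notin> P"
begin

lemma dilation_in_cantor_power:
  "x \<in> topspace (cantor_power n) \<Longrightarrow> dilation P c t e x \<in> topspace (cantor_power n)"
  using P t
  by (auto simp: topspace_cantor_power dilation_def push_def pull_def PiE_def extensional_def)

text \<open>
  The case distinction looks at most at the first \<open>2 * length c\<close> digits in the coordinates of \<open>P\<close> and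
  at the first digit in the coordinate \<open>t\<close>; these digits are all visible in a prefix
  of length \<open>2 * length c + 1\<close>. In each case one fixed prefix replacement remains.
\<close>

lemma uniformly_canonical_dilation:
  "uniformly_canonical n (2 * length c + 1) (\<lambda>x\<in>topspace (cantor_power n). dilation P c t e x)"
  unfolding uniformly_canonical_def
proof (intro allI impI)
  fix \<alpha> :: "nat \<Rightarrow> bool list" assume long: "\<forall>i<n. 2 * length c + 1 \<le> length (\<alpha> i)"
  let ?X = "topspace (cantor_power n)"
  define \<beta> where "\<beta> p = (if p \<in> P then c @ \<alpha> p else \<alpha> p)" for p
  define \<gamma> where "\<gamma> p = (if p \<in> P then drop (length c) (\<alpha> p) else \<alpha> p)" for p
  have push: "push P c (prepend n \<alpha> x) = prepend n \<beta> x" for x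
    using P by (auto simp: push_def prepend_def \<beta>_def fun_eq_iff)
  have pull: "pull P c (prepend n \<alpha> x) = prepend n \<gamma> x" for x
  proof
    fix p
    have "length c \<le> length (\<alpha> p)" if "p < n"
      using long that by fastforce
    then show "pull P c (prepend n \<alpha> x) p = prepend n \<gamma> x p"
      using P by (auto simp: pull_def prepend_def \<gamma>_def)
  qed
  have starts_\<alpha>: "starts_with P c (prepend n \<alpha> x) \<longleftrightarrow> (\<forall>p\<in>P. take (length c) (\<alpha> p) = c)" for x
    using P long by (force simp: starts_with_def prepend_def)
  have starts_\<gamma>: "starts_with P c (prepend n \<gamma> x) \<longleftrightarrow> (\<forall>p\<in>P. take (length c) (\<gamma> p) = c)" for x
    using P long by (force simp: starts_with_def prepend_def \<gamma>_def)
  have first: "prepend n \<alpha> x t 0 = hd (\<alpha> t)" for x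
    using t long by (cases "\<alpha> t") (auto simp: prepend_def)
  have cons: "(prepend n \<beta> x)(t := e ## prepend n \<alpha> x t) = prepend n (\<beta>(t := e # \<alpha> t)) x" for x
    using t by (auto simp: prepend_def)
  have tail: "(prepend n \<gamma> x)(t := suffix 1 (prepend n \<alpha> x t)) = prepend n (\<gamma>(t := drop 1 (\<alpha> t))) x" for x
  proof -
    have "1 \<le> length (\<alpha> t)"
      using t long by fastforce
    then show ?thesis
      using t by (auto simp: prepend_def \<gamma>_def fun_eq_iff)
  qed
  have "maps_canonically n \<alpha>
    (if \<not> (\<forall>p\<in>P. take (length c) (\<alpha> p) = c) then \<beta>(t := e # \<alpha> t)
     else if hd (\<alpha> t) = e then \<beta>
     else if \<forall>p\<in>P. take (length c) (\<gamma> p) = c then \<gamma>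
     else \<gamma>(t := drop 1 (\<alpha> t))) (\<lambda>x\<in>?X. dilation P c t e x)" (is "maps_canonically n \<alpha> ?\<delta> _")
    unfolding maps_canonically_def
    by (simp only: restrict_apply' prepend_in_cantor_power dilation_def push pull starts_\<alpha> starts_\<gamma>
        first cons tail split: if_split) auto
  then show "\<exists>\<delta>. maps_canonically n \<alpha> \<delta> (\<lambda>x\<in>?X. dilation P c t e x)"
    by blast
qed

lemma dilation_brin_thompson:
  "(\<lambda>x\<in>topspace (cantor_power n). dilation P c t e x) \<in> brin_thompson_maps n"
proof (rule uniformly_canonical_imp_brin_thompson[OF _ uniformly_canonical_dilation])
  let ?X = "topspace (cantor_power n)"
  have "bij_betw (dilation P c t e) ?X ?X"
    using dilation_inverse[OF t(2), of c e] dilation_inverse[OF t(2), of c "\<not> e"]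
    by (intro bij_betw_byWitness[where f' = "dilation P c t (\<not> e)"])
      (auto intro: dilation_in_cantor_power)
  then show "(\<lambda>x\<in>?X. dilation P c t e x) \<in> Bij ?X"
    by (simp add: Bij_def bij_betw_restrict_eq)
qed

end

lemma mult_brin_thompson:
  "f \<in> brin_thompson_maps n \<Longrightarrow> g \<in> brin_thompson_maps n \<Longrightarrow>
    f \<otimes>\<^bsub>brin_thompson n\<^esub> g = compose (topspace (cantor_power n)) f g"
  using brin_thompson_maps_subset_Bij by (auto simp: brin_thompson_def BijGroup_def)

text \<open>
  Ping-pong is played with total maps on all families of sequences, while the elements of \<open>nV\<close> are
  extensional on the Cantor cube. Restricting the total maps translates between the two.
\<close>

lemma word_value_brin_thompson:
  assumes inverse: "\<And>s b x. s \<in> S \<Longrightarrow> \<rho> (s, \<not> b) (\<rho> (s, b) x) = x"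
    and brin: "\<And>s b. s \<in> S \<Longrightarrow> restrict (\<rho> (s, b)) (topspace (cantor_power n)) \<in> brin_thompson_maps n"
    and "w \<in> group_words S"
  shows "word_value (brin_thompson n) (\<lambda>s. restrict (\<rho> (s, True)) (topspace (cantor_power n))) w
    = restrict (foldr \<rho> w) (topspace (cantor_power n))"
    (is "word_value _ ?f _ = _")
  using \<open>w \<in> group_words S\<close>
proof (induction w)
  case Nil
  then show ?case
    by (simp add: word_value_def brin_thompson_def BijGroup_def)
next
  case (Cons x w)
  let ?X = "topspace (cantor_power n)"
  interpret nV: group "brin_thompson n"
    by (rule group_brin_thompson)
  have carrier: "carrier (brin_thompson n) = brin_thompson_maps n"
    by (simp add: brin_thompson_def)
  have one: "\<one>\<^bsub>brin_thompson n\<^esub> = (\<lambda>y\<in>?X. y)"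
    by (simp add: brin_thompson_def BijGroup_def)
  obtain s b where x: "x = (s, b)" by (cases x)
  have s: "s \<in> S" and w: "w \<in> group_words S"
    using Cons.prems by (auto simp: x)
  have in_X: "\<rho> (s, b) y \<in> ?X" if "s \<in> S" "y \<in> ?X" for s b y
    using brin[OF that(1), of b] that(2) brin_thompson_maps_subset_Bij[of n]
    by (force simp: Bij_def dest: bij_betw_imp_funcset)
  have "inv\<^bsub>brin_thompson n\<^esub> ?f s = restrict (\<rho> (s, False)) ?X"
  proof (rule nV.inv_equality)
    show "restrict (\<rho> (s, False)) ?X \<otimes>\<^bsub>brin_thompson n\<^esub> ?f s = \<one>\<^bsub>brin_thompson n\<^esub>"
      using brin[OF s] inverse[OF s, of True] in_X[OF s]
      by (simp add: mult_brin_thompson compose_def one cong: restrict_cong)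
  qed (use brin s carrier in auto)
  then have letter: "(if b then ?f s else inv\<^bsub>brin_thompson n\<^esub> ?f s) = restrict (\<rho> (s, b)) ?X"
    by simp
  have "foldr \<rho> w y \<in> ?X" if "y \<in> ?X" for y
    using w that by (induction w) (auto simp: in_X)
  moreover have "word_value (brin_thompson n) ?f w \<in> brin_thompson_maps n"
    using nV.word_value_closed[of ?f S w] brin w by (auto simp: carrier)
  ultimately have "restrict (\<rho> (s, b)) ?X \<otimes>\<^bsub>brin_thompson n\<^esub> word_value (brin_thompson n) ?f w
      = restrict (foldr \<rho> (x # w)) ?X"
    using brin[OF s, of b] by (auto simp: mult_brin_thompson compose_def Cons.IH[OF w] x)
  then show ?case
    by (simp only: x word_value_simps letter)
qed

text \<open>
  No code word is a prefix of another one, so the cylinders of different code words in a common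
  coordinate are disjoint. The constantly true sequence begins with none of them, which leaves room
  for the base point.
\<close>

definition unary_code :: "nat \<Rightarrow> bool list" where
  "unary_code i = replicate i True @ [False]"

lemma length_unary_code [simp]: "length (unary_code i) = Suc i"
  by (simp add: unary_code_def)

lemma unary_code_unique:
  assumes "prefix (length (unary_code i)) w = unary_code i" "prefix (length (unary_code j)) w = unary_code j"
  shows "i = j"
proof -
  have "(LEAST k. \<not> w k) = i" if code: "prefix (length (unary_code i)) w = unary_code i" for i
  proof (rule Least_equality)
    have digit: "w k = unary_code i ! k" if "k \<le> i" for k
      using that arg_cong[OF code, of "\<lambda>u. u ! k"] by (simp del: subseq_to_Suc)
    show "\<not> w i"
      using digit[of i] by (simp add: unary_code_def nth_append)
    show "i \<le> k" if "\<not> w k" for k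
      using digit[of k] that by (cases "k < i") (auto simp: unary_code_def nth_append)
  qed
  then show ?thesis
    using assms by blast
qed

lemma unary_code_not_prefix: "prefix (length (unary_code i)) (\<lambda>_. True) \<noteq> unary_code i"
proof
  assume "prefix (length (unary_code i)) (\<lambda>_. True) = unary_code i"
  from arg_cong[OF this, of "\<lambda>u. u ! i"] show False
    by (simp add: unary_code_def nth_append del: subseq_to_Suc)
qed

text \<open>
  Every vertex \<open>v\<close> owns one coordinate \<open>t v\<close>, and every pair \<open>{v, w}\<close> of non-adjacent vertices
  contributes one coordinate that \<open>v\<close> and \<open>w\<close> share. The degenerate pair \<open>{v}\<close> counts as
  non-adjacent, so that \<open>P v\<close> is never empty.
\<close>

lemma ex_coordinates:
  fixes V :: "'a set" and E :: "('a \<times> 'a) set"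
  assumes "finite V" "irrefl E" "sym E"
  shows "\<exists>(n::nat) t P. (\<forall>v\<in>V. t v < n \<and> P v \<subseteq> {..<n} \<and> t v \<notin> P v \<and> P v \<noteq> {}) \<and>
    (\<forall>v\<in>V. \<forall>w\<in>V. if (v, w) \<in> E then insert (t v) (P v) \<inter> insert (t w) (P w) = {}
      else P v \<inter> P w \<noteq> {})"
proof -
  define K :: "('a + 'a set) set"
    where "K = Inl ` V \<union> {Inr {v, w} | v w. v \<in> V \<and> w \<in> V \<and> (v, w) \<notin> E}"
  have "K \<subseteq> Inl ` V \<union> Inr ` Pow V"
    by (auto simp: K_def)
  then have "finite K"
    using assms(1) by (auto intro: finite_subset)
  then obtain h :: "'a + 'a set \<Rightarrow> nat" where h: "inj_on h K" "h ` K = {..<card K}"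
    using ex_bij_betw_finite_nat[of K] by (auto simp: bij_betw_def lessThan_atLeast0)
  define N where "N v = {w \<in> V. (v, w) \<notin> E}" for v
  define P where "P v = (\<lambda>w. h (Inr {v, w})) ` N v" for v
  have h_eq: "h x = h y \<longleftrightarrow> x = y" if "x \<in> K" "y \<in> K" for x y
    using h(1) that by (simp add: inj_on_eq_iff)
  have K: "Inl v \<in> K" "w \<in> V \<Longrightarrow> (v, w) \<notin> E \<Longrightarrow> Inr {v, w} \<in> K" if "v \<in> V" for v w
    using that by (auto simp: K_def)
  have N: "v \<in> N v" if "v \<in> V" for v
    using that assms(2) by (auto simp: N_def irrefl_def)
  show ?thesis
  proof (intro exI[of _ "card K"] exI[of _ "\<lambda>v. h (Inl v)"] exI[of _ P] conjI[of "Ball _ _"] ballI)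
    fix v assume v: "v \<in> V"
    have "h (Inl v) < card K" "P v \<subseteq> {..<card K}"
      using h(2) K v by (auto simp: P_def N_def)
    moreover have "h (Inl v) \<notin> P v" "P v \<noteq> {}"
      using K v N by (auto simp: P_def N_def h_eq)
    ultimately show "h (Inl v) < card K \<and> P v \<subseteq> {..<card K} \<and> h (Inl v) \<notin> P v \<and> P v \<noteq> {}"
      by blast
  next
    fix v w assume vw: "v \<in> V" "w \<in> V"
    show "if (v, w) \<in> E then insert (h (Inl v)) (P v) \<inter> insert (h (Inl w)) (P w) = {}
      else P v \<inter> P w \<noteq> {}"
    proof (cases "(v, w) \<in> E")
      case True
      then have "v \<noteq> w" "(w, v) \<in> E"
        using assms(2,3) by (auto simp: irrefl_def sym_def)
      then show ?thesis
        using True vw K by (auto simp: P_def N_def h_eq doubleton_eq_iff)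
    next
      case False
      then have "(w, v) \<notin> E"
        using assms(3) by (auto simp: sym_def)
      with False have "h (Inr {v, w}) \<in> P v" "h (Inr {w, v}) \<in> P w"
        using vw by (auto simp: P_def N_def)
      then show ?thesis
        using False by (auto simp: insert_commute)
    qed
  qed
qed

section \<open>The embedding\<close>

theorem theorem1p1:
  fixes G :: "('a, 'b) pre_digraph"
  assumes "Digraph.graph G"
  shows "\<exists>n\<ge>1. \<exists>\<phi>\<in>hom (raag G) (brin_thompson n). inj_on \<phi> (carrier (raag G))"
proof -
  interpret Digraph.graph G by fact
  let ?V = "verts G" and ?E = "arcs_ends G"
  have irrefl: "irrefl ?E"
    using no_loops by (auto simp: irrefl_def arcs_ends_conv)
  have "sym ?E"
    using sym_arcs by (simp add: symmetric_def)
  from ex_coordinates[OF finite_verts irrefl this]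
  obtain m :: nat and t P where coord: "\<forall>v\<in>?V. t v < m \<and> P v \<subseteq> {..<m} \<and> t v \<notin> P v \<and> P v \<noteq> {}"
      and pairs: "\<forall>v\<in>?V. \<forall>w\<in>?V. if (v, w) \<in> ?E then insert (t v) (P v) \<inter> insert (t w) (P w) = {}
        else P v \<inter> P w \<noteq> {}"
    by blast
  have meet: "P v \<inter> P w \<noteq> {}" if "v \<in> ?V" "w \<in> ?V" "(v, w) \<notin> ?E" for v w
    using pairs that by simp
  have apart: "insert (t v) (P v) \<inter> insert (t w) (P w) = {}" if "(v, w) \<in> ?E" for v w
    using pairs[rule_format, of v w] that by (auto simp: arcs_ends_conv)
  obtain idx :: "'a \<Rightarrow> nat" where idx: "inj_on idx ?V"
    using finite_imp_inj_to_nat_seg[OF finite_verts] by blast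
  (* One spare coordinate keeps the dimension positive for the graph without vertices. *)
  define n where "n = Suc m"
  let ?X = "topspace (cantor_power n)"
  have coord_n: "P v \<subseteq> {..<n}" "t v < n" "t v \<notin> P v" if "v \<in> ?V" for v
  proof -
    have "P v \<subseteq> {..<m}" "t v < m" "t v \<notin> P v"
      using coord that by auto
    then show "P v \<subseteq> {..<n}" "t v < n" "t v \<notin> P v"
      by (auto simp: n_def)
  qed
  define c where "c v = unary_code (idx v)" for v
  define \<rho> where "\<rho> = (\<lambda>(v, b). dilation (P v) (c v) (t v) b)"
  define Q where "Q = (\<lambda>(v, b). pole (P v) (c v) (t v) b)"
  define x0 :: "nat \<Rightarrow> bool word" where "x0 = (\<lambda>i\<in>{..<n}. \<lambda>_. True)"
  define f where "f s = restrict (\<rho> (s, True)) ?X" for s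
  have inverse: "\<rho> (s, \<not> b) (\<rho> (s, b) x) = x" if "s \<in> ?V" for s b x
    using dilation_inverse coord_n[OF that] by (simp add: \<rho>_def)
  have brin: "restrict (\<rho> (s, b)) ?X \<in> brin_thompson_maps n" if "s \<in> ?V" for s b
    using dilation_brin_thompson coord_n[OF that] by (simp add: \<rho>_def)
  have word_value_eq: "word_value (brin_thompson n) f w = restrict (foldr \<rho> w) ?X"
    if "w \<in> group_words ?V" for w
    using word_value_brin_thompson[of ?V \<rho> n w] inverse brin that unfolding f_def by blast
  interpret nV: group "brin_thompson n"
    by (rule group_brin_thompson)
  have f: "f \<in> ?V \<rightarrow> carrier (brin_thompson n)"
    using brin by (auto simp: f_def brin_thompson_def)
  have comm: "\<rho> (v, True) (\<rho> (w, True) x) = \<rho> (w, True) (\<rho> (v, True) x)" if "(v, w) \<in> ?E" for v w x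
    using supported_on_commute[OF supported_on_dilation supported_on_dilation] apart[OF that]
    by (simp add: \<rho>_def)
  let ?R = "{([(v, True), (w, True)], [(w, True), (v, True)]) | v w. (v, w) \<in> ?E}"
  have rel: "word_value (brin_thompson n) f l = word_value (brin_thompson n) f r"
    if "(l, r) \<in> ?R" "l \<in> group_words ?V" "r \<in> group_words ?V" for l r
    using that by (auto simp: word_value_eq o_def intro!: restrict_ext comm)
  obtain \<phi> where \<phi>: "\<phi> \<in> hom (presented_group ?V ?R) (brin_thompson n)"
    and \<phi>_word: "\<And>w. w \<in> group_words ?V \<Longrightarrow>
      \<phi> (raag_cong G `` {w}) = word_value (brin_thompson n) f w"
    using nV.presented_group_hom[OF f rel] by blast
  have \<phi>: "\<phi> \<in> hom (raag G) (brin_thompson n)"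
    using \<phi> by (simp add: raag_def)
  have faithful: "u = []" if u: "geodesic_word G u" "foldr \<rho> u x0 = x0" for u
  proof (rule raag_ping_pong[of G \<rho> Q x0])
    show "Digraph.graph G" "geodesic_word G u" "foldr \<rho> u x0 = x0"
      by (fact assms u)+
    show "\<rho> (s, \<not> b) (\<rho> (s, b) x) = x" if "s \<in> ?V" for s b x
      by (rule inverse[OF that])
    show "\<rho> (s, b) x \<in> Q (s, b)" if "s \<in> ?V" "x \<notin> Q (s, \<not> b)" for s b x
      using that dilation_attract coord_n by (simp add: \<rho>_def Q_def)
  next
    show "Q (s, b) \<inter> Q (s', b') = {}"
      if s: "s \<in> ?V" "s' \<in> ?V" "(s, s') \<notin> ?E" "(s, b) \<noteq> (s', b')" for s b s' b'
    proof (rule ccontr)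
      assume "Q (s, b) \<inter> Q (s', b') \<noteq> {}"
      then obtain x where x: "x \<in> Q (s, b)" "x \<in> Q (s', b')"
        by blast
      obtain p where "p \<in> P s" "p \<in> P s'"
        using meet[OF s(1-3)] by blast
      then have "idx s = idx s'"
        using x unary_code_unique[where i = "idx s" and j = "idx s'" and w = "x p"]
        by (simp add: Q_def pole_def starts_with_def c_def)
      then have "s = s'"
        using idx s(1,2) by (auto dest: inj_onD)
      then show False
        using x s(4) by (simp add: Q_def pole_def)
    qed
  next
    show "\<rho> (s, b) x \<in> Q (s', b')" if "(s, s') \<in> ?E" "x \<in> Q (s', b')" for s b s' b' x
      using pole_invariant[OF supported_on_dilation apart] that
      by (simp add: \<rho>_def Q_def)
  next
    show "x0 \<notin> Q (s, b)" if s: "s \<in> ?V" for s b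
    proof -
      obtain p where p: "p \<in> P s"
        using coord s by blast
      then have "x0 p = (\<lambda>_. True)"
        using coord_n(1)[OF s] by (auto simp: x0_def)
      then have "\<not> starts_with (P s) (c s) x0"
        using p unary_code_not_prefix[of "idx s"] unfolding starts_with_def c_def by metis
      then show ?thesis
        by (simp add: Q_def pole_def)
    qed
  qed
  have "inj_on \<phi> (carrier (raag G))"
    unfolding inj_on_one_iff'[OF \<phi> group_raag nV.group_axioms]
  proof (intro allI impI)
    fix A assume A: "A \<in> carrier (raag G)" "\<phi> A = \<one>\<^bsub>brin_thompson n\<^esub>"
    then obtain w where w: "w \<in> group_words ?V" "A = raag_cong G `` {w}"
      by (auto simp: raag_def presented_group_def quotient_def)
    obtain u where u: "(w, u) \<in> raag_cong G" "geodesic_word G u"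
      using ex_geodesic_word[OF w(1)] by blast
    have A_u: "A = raag_cong G `` {u}"
      using w(2) equiv_class_eq[OF equiv_presentation_cong u(1)] by simp
    have "x0 \<in> ?X"
      by (simp add: x0_def topspace_cantor_power)
    moreover have "restrict (foldr \<rho> u) ?X = (\<lambda>x\<in>?X. x)"
      using A(2) A_u \<phi>_word word_value_eq u(2)
      by (simp add: geodesic_word_def brin_thompson_def BijGroup_def)
    ultimately have "foldr \<rho> u x0 = x0"
      by (metis restrict_apply')
    then have "u = []"
      using faithful u(2) by blast
    then show "A = \<one>\<^bsub>raag G\<^esub>"
      using A_u by (simp add: raag_def presented_group_def)
  qed
  then show ?thesis
    using \<phi> by (intro exI[of _ n]) (auto simp: n_def)
qed

end
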